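(* The objective function of the maximum capture problem under generalized extreme value (GEV) models, $$f^{\mathrm{GEV}}(S)=\sum_{i\in I}q_i-\sum_{i\in I}\frac{q_i}{1+G^i(\mathbf{Y}^i|S)},\qquad S\subseteq[m],$$ is submodular; that is, for all $A\subseteq B\subseteq[m]$ and all $j\in[m]\setminus B$, $$f^{\mathrm{GEV}}(A\cup\{j\})-f^{\mathrm{GEV}}(A)\ \ge\ f^{\mathrm{GEV}}(B\cup\{j\})-f^{\mathrm{GEV}}(B).$$
   Context: Let $[m]=\{1,\dots,m\}$ be the set of candidate locations, and $I$ a finite nonempty set of customer zones. Zone $i\in I$ has $q_i>0$ customers, with deterministic utilities $v_{ij}\in\mathbb{R}$ for $j\in[m]$; let $\mathbf{Y}^i\in\mathbb{R}^m$ have entries $Y^i_j=e^{v_{ij}}>0$. Each zone $i$ has a choice probability generating function (CPGF) $G^i$ of a GEV model. A CPGF is a function $G:\mathbb{R}^m_+\to\mathbb{R}$ on the closed nonnegative orthant, continuous on $\mathbb{R}^m_+$ and possessing continuous mixed partial derivatives of all orders on the open positive orthant (where $\partial G_{j_1\dots j_k}$ denotes the mixed partial derivative with respect to $Y_{j_1},\dots,Y_{j_k}$), such that: (i) $G(\mathbf{Y})\ge 0$ for all $\mathbf{Y}\in\mathbb{R}^m_+$; (ii) $G(\lambda\mathbf{Y})=\lambda G(\mathbf{Y})$ for all $\lambda>0$; (iii) $G(\mathbf{Y})\to\infty$ if $Y_j\to\infty$ for some $j$; (iv) on the open positive orthant, for distinct $j_1,\dots,j_k\in[m]$: $\partial G_{j_1}(\mathbf{Y})>0$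 when $k=1$, $\partial G_{j_1\dots j_k}(\mathbf{Y})\ge 0$ when $k\geq 3$ is odd, and $\partial G_{j_1\dots j_k}(\mathbf{Y})\le 0$ when $k$ is even; (v) $G(\mathbf{Y})=\sum_{j\in[m]}Y_j\,\partial G_j(\mathbf{Y})$ on the open positive orthant; (vi) $\sum_{k\in[m]}Y_k\,\partial G_{jk}(\mathbf{Y})=0$ for all $j\in[m]$ on the open positive orthant. For $S\subseteq[m]$, $G^i(\mathbf{Y}^i|S):=G^i(\widetilde{\mathbf{Y}}^i)$, where $\widetilde Y^i_j=Y^i_j$ if $j\in S$ and $\widetilde Y^i_j=0$ otherwise. The quantity $f^{\mathrm{GEV}}(S)$ is the expected captured demand when facilities are opened at $S$ (the competitors' total utility being normalized to $1$). *)

theory Defs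
  imports "HOL-Analysis.Analysis"
begin

text \<open>The candidate locations are the elements of a finite type \<open>'m\<close>, whose cardinality is
  the number m of locations; vectors indexed by them have type \<open>real ^ 'm\<close>.\<close>

definition nonneg_orthant :: "(real ^ 'm) set" where
  "nonneg_orthant = {Y. \<forall>j. 0 \<le> Y $ j}"

definition pos_orthant :: "(real ^ 'm) set" where
  "pos_orthant = {Y. \<forall>j. 0 < Y $ j}"

text \<open>As \<open>deriv\<close> is total, these are meaningful only where the derivatives exist; on the positive
  orthant this is part of \<open>smooth_on_pos_orthant\<close>. That set is open, so there the values depend
  only on the restriction of the function to the orthant.\<close>

definition partial_deriv :: "'m \<Rightarrow> (real ^ 'm \<Rightarrow> real) \<Rightarrow> real ^ 'm \<Rightarrow> real" where
  "partial_deriv j F Y = deriv (\<lambda>t. F (Y + t *\<^sub>R axis j 1)) 0"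

fun mixed_partial :: "'m list \<Rightarrow> (real ^ 'm \<Rightarrow> real) \<Rightarrow> real ^ 'm \<Rightarrow> real" where
  "mixed_partial [] F = F"
| "mixed_partial (j # js) F = mixed_partial js (partial_deriv j F)"

text \<open>The list of indices may contain repetitions.\<close>

definition smooth_on_pos_orthant :: "(real ^ 'm \<Rightarrow> real) \<Rightarrow> bool" where
  "smooth_on_pos_orthant F \<longleftrightarrow>
     (\<forall>js. continuous_on pos_orthant (mixed_partial js F) \<and>
       (\<forall>j. \<forall>Y\<in>pos_orthant.
          (\<lambda>t. mixed_partial js F (Y + t *\<^sub>R axis j 1)) field_differentiable at 0))"

text \<open>Choice probability generating functions. Only the values of \<open>G\<close> on the nonnegative
  orthant matter. In the limit condition the coordinate \<open>j\<close> tends to infinity while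
  the others are held fixed.\<close>

definition cpgf :: "(real ^ 'm \<Rightarrow> real) \<Rightarrow> bool" where
  "cpgf G \<longleftrightarrow>
     continuous_on nonneg_orthant G \<and>
     smooth_on_pos_orthant G \<and>
     (\<forall>Y\<in>nonneg_orthant. 0 \<le> G Y) \<and>
     (\<forall>Y\<in>nonneg_orthant. \<forall>c>0. G (c *\<^sub>R Y) = c * G Y) \<and>
     (\<forall>Y\<in>nonneg_orthant. \<forall>j. filterlim (\<lambda>t. G (\<chi> k. if k = j then t else Y $ k)) at_top at_top) \<and>
     (\<forall>Y\<in>pos_orthant.
        (\<forall>j. 0 < mixed_partial [j] G Y) \<and>
        (\<forall>js. distinct js \<longrightarrow> 3 \<le> length js \<longrightarrow> odd (length js) \<longrightarrow> 0 \<le> mixed_partial js G Y) \<and>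
        (\<forall>js. distinct js \<longrightarrow> js \<noteq> [] \<longrightarrow> even (length js) \<longrightarrow> mixed_partial js G Y \<le> 0)) \<and>
     (\<forall>Y\<in>pos_orthant. G Y = (\<Sum>j\<in>UNIV. Y $ j * mixed_partial [j] G Y)) \<and>
     (\<forall>Y\<in>pos_orthant. \<forall>j. (\<Sum>k\<in>UNIV. Y $ k * mixed_partial [j, k] G Y) = 0)"

definition restrict_vec :: "real ^ 'm \<Rightarrow> 'm set \<Rightarrow> real ^ 'm" where
  "restrict_vec Y S = (\<chi> j. if j \<in> S then Y $ j else 0)"

definition f_gev ::
  "'i set \<Rightarrow> ('i \<Rightarrow> real) \<Rightarrow> ('i \<Rightarrow> 'm \<Rightarrow> real) \<Rightarrow> ('i \<Rightarrow> real ^ 'm \<Rightarrow> real) \<Rightarrow> 'm set \<Rightarrow> real"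
where
  "f_gev I q v G S =
     (\<Sum>i\<in>I. q i) - (\<Sum>i\<in>I. q i / (1 + G i (restrict_vec (\<chi> j. exp (v i j)) S)))"

definition submodular :: "('a set \<Rightarrow> real) \<Rightarrow> bool" where
  "submodular f \<longleftrightarrow>
     (\<forall>A B j. A \<subseteq> B \<longrightarrow> j \<notin> B \<longrightarrow> f (A \<union> {j}) - f A \<ge> f (B \<union> {j}) - f B)"

end

theory Submission
  imports Defs
begin

text \<open>For a single zone, let \<open>g S\<close> be the value of the CPGF \<open>G\<close> at the utility vector restricted to
  \<open>S\<close>. The sign conditions of order one and two say that on the open orthant \<open>G\<close> increases in
  every coordinate and that \<open>\<partial>\<^sub>j G\<close> decreases in every other coordinate \<open>k\<close>. Integrating twice, the
  increment of \<open>G\<close> along \<open>j\<close> shrinks when coordinate \<open>k\<close> is raised. Opening a location raises its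
  coordinate from \<open>0\<close>, so the vectors in question lie on the boundary of the orthant, where no
  derivative is available; they are shifted into the interior by \<open>\<epsilon> > 0\<close> in every coordinate, and
  continuity of \<open>G\<close> lets \<open>\<epsilon>\<close> tend to \<open>0\<close> (\<open>cpgf_restrict_mono_step\<close>, \<open>cpgf_restrict_submodular_step\<close>).
  Adding locations one at a time, \<open>g\<close> is monotone and submodular.

  The captured share is \<open>1 - 1 / (1 + g S)\<close>, a concave increasing function of \<open>g\<close>; such a
  function of a monotone submodular set function is again submodular
  (\<open>captured_share_diminishing\<close>). Positive combinations over the zones preserve this.\<close>

section \<open>Functions on the positive orthant with a signed partial derivative\<close>

lemma pos_orthant_add_axis:
  assumes "X \<in> pos_orthant" and "0 \<le> s"
  shows "X + s *\<^sub>R axis k 1 \<in> pos_orthant"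
  using assms by (auto simp: pos_orthant_def axis_def add_pos_nonneg)

lemma partial_deriv_along_axis:
  assumes "(\<lambda>u. F ((X + t *\<^sub>R axis k 1) + u *\<^sub>R axis k 1)) field_differentiable at 0"
  shows "((\<lambda>t. F (X + t *\<^sub>R axis k 1)) has_real_derivative
           partial_deriv k F (X + t *\<^sub>R axis k 1)) (at t)"
proof -
  have "((\<lambda>u. F ((X + t *\<^sub>R axis k 1) + u *\<^sub>R axis k 1)) has_real_derivative
          partial_deriv k F (X + t *\<^sub>R axis k 1)) (at 0)"
    using assms unfolding partial_deriv_def by (simp add: DERIV_deriv_iff_field_differentiable)
  then have "((\<lambda>u. F (X + (u + t) *\<^sub>R axis k 1)) has_real_derivative
          partial_deriv k F (X + t *\<^sub>R axis k 1)) (at 0)"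
    by (simp add: algebra_simps)
  then show ?thesis
    using DERIV_shift[of "\<lambda>t. F (X + t *\<^sub>R axis k 1)" _ 0 t] by simp
qed

lemma partial_deriv_nonpos_imp_antimono:
  assumes diff: "\<And>Y. Y \<in> pos_orthant \<Longrightarrow> (\<lambda>t. F (Y + t *\<^sub>R axis k 1)) field_differentiable at 0"
    and nonpos: "\<And>Y. Y \<in> pos_orthant \<Longrightarrow> partial_deriv k F Y \<le> 0"
    and X: "X \<in> pos_orthant" and s: "0 \<le> s"
  shows "F (X + s *\<^sub>R axis k 1) \<le> F X"
proof -
  have "F (X + s *\<^sub>R axis k 1) \<le> F (X + 0 *\<^sub>R axis k 1)"
  proof (rule DERIV_nonpos_imp_nonincreasing[OF s])
    fix t :: real assume "0 \<le> t" "t \<le> s"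
    then have "X + t *\<^sub>R axis k 1 \<in> pos_orthant"
      using X by (simp add: pos_orthant_add_axis)
    then show "\<exists>y. ((\<lambda>t. F (X + t *\<^sub>R axis k 1)) has_real_derivative y) (at t) \<and> y \<le> 0"
      using partial_deriv_along_axis diff nonpos by blast
  qed
  then show ?thesis by simp
qed

section \<open>Increments of a CPGF on the positive orthant\<close>

lemma cpgf_partial_deriv_pos:
  assumes "cpgf G" and "Y \<in> pos_orthant"
  shows "0 < partial_deriv j G Y"
  using assms unfolding cpgf_def by (auto dest!: bspec[of pos_orthant])

lemma cpgf_mixed_partial_nonpos:
  assumes "cpgf G" and "Y \<in> pos_orthant" and "j \<noteq> k"
  shows "partial_deriv k (partial_deriv j G) Y \<le> 0"
proof -
  have "distinct [j, k] \<longrightarrow> [j, k] \<noteq> [] \<longrightarrow> even (length [j, k]) \<longrightarrow> mixed_partial [j, k] G Y \<le> 0"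
    using assms(1,2) unfolding cpgf_def by blast
  then show ?thesis using assms(3) by simp
qed

lemma cpgf_differentiable:
  assumes "cpgf G" and "Y \<in> pos_orthant"
  shows "(\<lambda>t. G (Y + t *\<^sub>R axis j 1)) field_differentiable at 0"
proof -
  have "(\<lambda>t. mixed_partial [] G (Y + t *\<^sub>R axis j 1)) field_differentiable at 0"
    using assms unfolding cpgf_def smooth_on_pos_orthant_def by blast
  then show ?thesis by simp
qed

lemma cpgf_partial_deriv_differentiable:
  assumes "cpgf G" and "Y \<in> pos_orthant"
  shows "(\<lambda>t. partial_deriv k G (Y + t *\<^sub>R axis j 1)) field_differentiable at 0"
proof -
  have "(\<lambda>t. mixed_partial [k] G (Y + t *\<^sub>R axis j 1)) field_differentiable at 0"
    using assms unfolding cpgf_def smooth_on_pos_orthant_def by blast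
  then show ?thesis by simp
qed

lemma cpgf_mono_axis:
  assumes G: "cpgf G" and "X \<in> pos_orthant" and "0 \<le> s"
  shows "G X \<le> G (X + s *\<^sub>R axis k 1)"
proof -
  have "(\<lambda>Y. - G Y) (X + s *\<^sub>R axis k 1) \<le> (\<lambda>Y. - G Y) X"
  proof (rule partial_deriv_nonpos_imp_antimono[OF _ _ assms(2,3)])
    fix Y :: "real ^ 'a" assume Y: "Y \<in> pos_orthant"
    note d = cpgf_differentiable[OF G Y, of k]
    show "(\<lambda>t. - G (Y + t *\<^sub>R axis k 1)) field_differentiable at 0"
      using d by (rule field_differentiable_minus)
    show "partial_deriv k (\<lambda>Y. - G Y) Y \<le> 0"
      using deriv_minus[OF d] cpgf_partial_deriv_pos[OF G Y, of k]
      by (simp add: partial_deriv_def)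
  qed
  then show ?thesis by simp
qed

text \<open>The gap \<open>\<lambda>Z. G (Z + s e\<^sub>k) - G Z\<close> has partial derivative
  \<open>\<partial>\<^sub>j G (Z + s e\<^sub>k) - \<partial>\<^sub>j G Z\<close> along \<open>j\<close>, which is nonpositive because \<open>\<partial>\<^sub>j G\<close> itself decreases
  along \<open>k\<close>: the one-dimensional monotonicity criterion is used once for each direction.\<close>

lemma cpgf_decreasing_differences_axis:
  assumes G: "cpgf G" and X: "X \<in> pos_orthant" and s: "0 \<le> s" and t: "0 \<le> t" and "j \<noteq> k"
  shows "G (X + t *\<^sub>R axis j 1 + s *\<^sub>R axis k 1) - G (X + t *\<^sub>R axis j 1)
       \<le> G (X + s *\<^sub>R axis k 1) - G X"
proof (rule partial_deriv_nonpos_imp_antimono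
    [of "\<lambda>Z. G (Z + s *\<^sub>R axis k 1) - G Z" j, OF _ _ X t])
  fix Y :: "real ^ 'a" assume Y: "Y \<in> pos_orthant"
  then have Ys: "Y + s *\<^sub>R axis k 1 \<in> pos_orthant"
    using s by (rule pos_orthant_add_axis)
  have d1: "(\<lambda>u. G (Y + u *\<^sub>R axis j 1 + s *\<^sub>R axis k 1)) field_differentiable at 0"
    using cpgf_differentiable[OF G Ys, of j] by (simp add: add_ac)
  note d2 = cpgf_differentiable[OF G Y, of j]
  show "(\<lambda>u. G (Y + u *\<^sub>R axis j 1 + s *\<^sub>R axis k 1) - G (Y + u *\<^sub>R axis j 1))
          field_differentiable at 0"
    using d1 d2 by (rule field_differentiable_diff)
  have "partial_deriv j (\<lambda>Z. G (Z + s *\<^sub>R axis k 1) - G Z) Y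
      = partial_deriv j G (Y + s *\<^sub>R axis k 1) - partial_deriv j G Y"
    using deriv_diff[OF d1 d2] by (simp add: partial_deriv_def add_ac)
  also have "\<dots> \<le> 0"
    using partial_deriv_nonpos_imp_antimono[of "partial_deriv j G" k, OF _ _ Y s]
      cpgf_partial_deriv_differentiable[OF G] cpgf_mixed_partial_nonpos[OF G _ \<open>j \<noteq> k\<close>]
    by auto
  finally show "partial_deriv j (\<lambda>Z. G (Z + s *\<^sub>R axis k 1) - G Z) Y \<le> 0" .
qed

section \<open>Passage to the boundary of the orthant\<close>

lemma restrict_vec_insert:
  assumes "k \<notin> S"
  shows "restrict_vec Y (insert k S) = restrict_vec Y S + Y $ k *\<^sub>R axis k 1"
  using assms by (auto simp: vec_eq_iff restrict_vec_def axis_def)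

lemma restrict_vec_shift_pos:
  assumes "Y \<in> pos_orthant" and "0 < e"
  shows "restrict_vec Y S + vec e \<in> pos_orthant"
  using assms by (auto simp: pos_orthant_def restrict_vec_def add_pos_pos)

lemma restrict_vec_nonneg:
  assumes "Y \<in> pos_orthant"
  shows "restrict_vec Y S \<in> nonneg_orthant"
  using assms by (auto simp: pos_orthant_def nonneg_orthant_def restrict_vec_def less_imp_le)

lemma cpgf_restrict_limit:
  assumes G: "cpgf G" and Y: "Y \<in> pos_orthant"
  shows "((\<lambda>e. G (restrict_vec Y S + vec e)) \<longlongrightarrow> G (restrict_vec Y S)) (at_right 0)"
proof (rule continuous_on_tendsto_compose[of nonneg_orthant G])
  show "continuous_on nonneg_orthant G"
    using G by (simp add: cpgf_def)
  show "restrict_vec Y S \<in> nonneg_orthant"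
    using Y by (rule restrict_vec_nonneg)
  show "\<forall>\<^sub>F e in at_right 0. restrict_vec Y S + vec e \<in> nonneg_orthant"
    using restrict_vec_shift_pos[OF Y]
    by (auto simp: eventually_at_filter pos_orthant_def nonneg_orthant_def less_imp_le)
  show "((\<lambda>e. restrict_vec Y S + vec e) \<longlongrightarrow> restrict_vec Y S) (at_right 0)"
    by (rule vec_tendstoI) (auto intro!: tendsto_eq_intros)
qed

lemma cpgf_restrict_mono_step:
  assumes G: "cpgf G" and Y: "Y \<in> pos_orthant" and k: "k \<notin> S"
  shows "G (restrict_vec Y S) \<le> G (restrict_vec Y (insert k S))"
proof (rule tendsto_le[OF _ cpgf_restrict_limit[OF G Y] cpgf_restrict_limit[OF G Y]])
  have Yk: "0 \<le> Y $ k" using Y by (auto simp: pos_orthant_def less_imp_le)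
  have "G (restrict_vec Y S + vec e) \<le> G (restrict_vec Y (insert k S) + vec e)" if "0 < e" for e
    using cpgf_mono_axis[OF G restrict_vec_shift_pos[OF Y that, of S] Yk, of k]
    by (simp add: restrict_vec_insert[OF k] add_ac)
  then show "\<forall>\<^sub>F e in at_right 0.
      G (restrict_vec Y S + vec e) \<le> G (restrict_vec Y (insert k S) + vec e)"
    by (simp add: eventually_at_filter)
qed simp

lemma cpgf_restrict_submodular_step:
  assumes G: "cpgf G" and Y: "Y \<in> pos_orthant" and jk: "j \<notin> S" "k \<notin> S" "j \<noteq> k"
  shows "G (restrict_vec Y (insert j (insert k S))) - G (restrict_vec Y (insert k S))
       \<le> G (restrict_vec Y (insert j S)) - G (restrict_vec Y S)"
proof (rule tendsto_le[OF _ tendsto_diff tendsto_diff])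
  have nn: "0 \<le> Y $ j" "0 \<le> Y $ k" using Y by (auto simp: pos_orthant_def less_imp_le)
  have "G (restrict_vec Y (insert j (insert k S)) + vec e) - G (restrict_vec Y (insert k S) + vec e)
      \<le> G (restrict_vec Y (insert j S) + vec e) - G (restrict_vec Y S + vec e)" if "0 < e" for e
    using cpgf_decreasing_differences_axis
        [OF G restrict_vec_shift_pos[OF Y that, of S] nn(1) nn(2) jk(3)[symmetric]] jk
    by (simp add: restrict_vec_insert add_ac)
  then show "\<forall>\<^sub>F e in at_right 0.
      G (restrict_vec Y (insert j (insert k S)) + vec e) - G (restrict_vec Y (insert k S) + vec e)
      \<le> G (restrict_vec Y (insert j S) + vec e) - G (restrict_vec Y S + vec e)"
    by (simp add: eventually_at_filter)
qed (rule cpgf_restrict_limit[OF G Y] | simp)+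

section \<open>Monotonicity and submodularity of set functions\<close>

lemma mono_from_single_insertions:
  fixes g :: "'a set \<Rightarrow> real"
  assumes step: "\<And>S k. k \<notin> S \<Longrightarrow> g S \<le> g (insert k S)"
    and "finite B" and "A \<subseteq> B"
  shows "g A \<le> g B"
proof -
  have "g A \<le> g (A \<union> C)" if "finite C" for C
    using that
  proof induction
    case (insert k C)
    then show ?case
      using step[of k "A \<union> C"] by (cases "k \<in> A \<union> C") (auto simp: insert_absorb)
  qed simp
  from this[of B] assms(2,3) show ?thesis by (simp add: Un_absorb1)
qed

lemma diminishing_from_single_insertions:
  fixes g :: "'a set \<Rightarrow> real"
  assumes step: "\<And>S j k. j \<notin> S \<Longrightarrow> k \<notin> S \<Longrightarrow> j \<noteq> k \<Longrightarrow>
        g (insert j (insert k S)) - g (insert k S) \<le> g (insert j S) - g S"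
    and "finite B" and "A \<subseteq> B" and "j \<notin> B"
  shows "g (insert j B) - g B \<le> g (insert j A) - g A"
proof -
  have "j \<notin> A" using assms by blast
  have "g (insert j (A \<union> C)) - g (A \<union> C) \<le> g (insert j A) - g A" if "finite C" "j \<notin> C" for C
    using that
  proof induction
    case (insert k C)
    then show ?case
      using step[of j "A \<union> C" k] \<open>j \<notin> A\<close>
      by (cases "k \<in> A \<union> C") (auto simp: insert_absorb)
  qed simp
  from this[of B] assms(2-4) show ?thesis by (simp add: Un_absorb1)
qed

text \<open>With \<open>a, a', b, b'\<close> the values of a set function at \<open>A\<close>, \<open>A \<union> {j}\<close>, \<open>B\<close>, \<open>B \<union> {j}\<close>, the right
  side is \<open>(a' - a) / ((1 + a) (1 + a'))\<close> and the left side the same expression in \<open>b, b'\<close>. Passing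
  from \<open>A\<close> to \<open>B\<close> shrinks the numerator by submodularity and enlarges the denominator by
  monotonicity.\<close>

lemma captured_share_diminishing:
  fixes a a' b b' :: real
  assumes "0 \<le> a" "a \<le> a'" "a \<le> b" "a' \<le> b'" "b \<le> b'" and dim: "b' - b \<le> a' - a"
  shows "1 / (1 + b) - 1 / (1 + b') \<le> 1 / (1 + a) - 1 / (1 + a')"
proof -
  have diff: "1 / (1 + x) - 1 / (1 + y) = (y - x) / ((1 + x) * (1 + y))"
    if "0 \<le> x" "0 \<le> y" for x y :: real
    using that by (simp add: diff_frac_eq)
  have "(b' - b) / ((1 + b) * (1 + b')) \<le> (a' - a) / ((1 + a) * (1 + a'))"
    using assms by (intro frac_le mult_mono mult_pos_pos) auto
  then show ?thesis using assms by (simp add: diff)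
qed

section \<open>The captured demand\<close>

theorem theorem1:
  fixes I :: "'i set"
    and q :: "'i \<Rightarrow> real"
    and v :: "'i \<Rightarrow> 'm::finite \<Rightarrow> real"
    and G :: "'i \<Rightarrow> real ^ 'm \<Rightarrow> real"
  assumes "finite I" and "I \<noteq> {}"
    and "\<And>i. i \<in> I \<Longrightarrow> 0 < q i"
    and "\<And>i. i \<in> I \<Longrightarrow> cpgf (G i)"
  shows "submodular (f_gev I q v G)"
  unfolding submodular_def
proof (intro allI impI)
  fix A B :: "'m set" and j
  assume AB: "A \<subseteq> B" and j: "j \<notin> B"
  define g where "g i S = G i (restrict_vec (\<chi> j. exp (v i j)) S)" for i S
  have gain: "f_gev I q v G (S \<union> {j}) - f_gev I q v G S
      = (\<Sum>i\<in>I. q i * (1 / (1 + g i S) - 1 / (1 + g i (insert j S))))" for S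
    by (simp add: f_gev_def g_def sum_subtractf right_diff_distrib)
  have "1 / (1 + g i B) - 1 / (1 + g i (insert j B))
      \<le> 1 / (1 + g i A) - 1 / (1 + g i (insert j A))" if i: "i \<in> I" for i
  proof -
    have Y: "(\<chi> j. exp (v i j)) \<in> pos_orthant" by (simp add: pos_orthant_def)
    note G = assms(4)[OF i]
    have mono: "g i S \<le> g i T" if "S \<subseteq> T" for S T
    proof (rule mono_from_single_insertions[OF _ _ that])
      show "g i S \<le> g i (insert k S)" if "k \<notin> S" for S k
        unfolding g_def using that by (rule cpgf_restrict_mono_step[OF G Y])
    qed simp
    have dim: "g i (insert j B) - g i B \<le> g i (insert j A) - g i A"
    proof (rule diminishing_from_single_insertions[OF _ _ AB j])
      show "g i (insert l (insert k S)) - g i (insert k S) \<le> g i (insert l S) - g i S"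
        if "l \<notin> S" "k \<notin> S" "l \<noteq> k" for S l k
        unfolding g_def using that by (rule cpgf_restrict_submodular_step[OF G Y])
    qed simp
    have "0 \<le> g i A"
      using G restrict_vec_nonneg[OF Y] by (simp add: cpgf_def g_def)
    then show ?thesis
      using AB by (intro captured_share_diminishing mono dim) auto
  qed
  then show "f_gev I q v G (A \<union> {j}) - f_gev I q v G A \<ge> f_gev I q v G (B \<union> {j}) - f_gev I q v G B"
    unfolding gain using assms(3) by (intro sum_mono mult_left_mono) (auto simp: less_imp_le)
qed

end
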